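(* Deciding whether a degree sequence $d$ admits a bipartite multigraph realization can be done in pseudo-polynomial time.
   Context: A degree sequence is a non-increasing sequence of positive integers with even sum. A bipartite multigraph realization of $d$ is a loopless multigraph (parallel edges allowed, no self-loops) whose underlying simple graph is bipartite and whose degree sequence equals $d$. Pseudo-polynomial time means time polynomial in $n$ and in the numeric values of the entries (e.g. in $\sum d$). *)

theory Defs
  imports
    Main
    "HOL-Library.Multiset"
    "HOL-Computational_Algebra.Polynomial"
begin

section \<open>Degree sequences and bipartite multigraphs\<close>

definition degree_sequence :: "nat list \<Rightarrow> bool" where
  "degree_sequence d \<longleftrightarrow> sorted_wrt (\<ge>) d \<and> (\<forall>x\<in>set d. 0 < x) \<and> even (sum_list d)"

text \<open>A multigraph is a vertex set together with a multiset of edges; an edge is the set of its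
  two endpoints, so the condition \<open>card e = 2\<close> excludes self-loops.\<close>

definition loopless_multigraph :: "'v set \<Rightarrow> 'v set multiset \<Rightarrow> bool" where
  "loopless_multigraph V E \<longleftrightarrow> finite V \<and> (\<forall>e\<in>#E. e \<subseteq> V \<and> card e = 2)"

definition mg_degree :: "'v set multiset \<Rightarrow> 'v \<Rightarrow> nat" where
  "mg_degree E v = size (filter_mset (\<lambda>e. v \<in> e) E)"

definition mg_degree_sequence :: "'v set \<Rightarrow> 'v set multiset \<Rightarrow> nat list" where
  "mg_degree_sequence V E = rev (sorted_list_of_multiset (image_mset (mg_degree E) (mset_set V)))"

definition bipartite :: "'v set \<Rightarrow> 'v set set \<Rightarrow> bool" where
  "bipartite V F \<longleftrightarrow>
     (\<exists>A B. A \<union> B = V \<and> A \<inter> B = {} \<and> (\<forall>e\<in>F. \<exists>a\<in>A. \<exists>b\<in>B. e = {a, b}))"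

text \<open>The underlying simple graph of \<open>(V, E)\<close> is \<open>(V, set_mset E)\<close>. Taking the vertices to be
  natural numbers loses no generality, since the graphs are finite.\<close>

definition has_bipartite_multigraph_realization :: "nat list \<Rightarrow> bool" where
  "has_bipartite_multigraph_realization d \<longleftrightarrow>
     (\<exists>(V :: nat set) E. loopless_multigraph V E \<and> bipartite V (set_mset E) \<and>
        mg_degree_sequence V E = d)"

section \<open>Deterministic multi-tape Turing machines\<close>

datatype head_move = Move_Left | Stay | Move_Right

text \<open>States are the numbers below \<open>num_states\<close> and tape symbols the numbers below
  \<open>num_symbols\<close>, where \<open>0\<close> is the blank. The transition function maps a state and the list of
  scanned symbols (one per tape) to a new state and, for each tape, the symbol to write and the
  head movement.\<close>

record turing_machine =
  num_tapes :: nat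
  num_states :: nat
  num_symbols :: nat
  start_state :: nat
  accept_state :: nat
  reject_state :: nat
  transition :: "nat \<Rightarrow> nat list \<Rightarrow> nat \<times> (nat \<times> head_move) list"

text \<open>At least four symbols are required, namely the blank and the three symbols occurring in
  inputs (see \<open>encode\<close> below).\<close>

definition wf_tm :: "turing_machine \<Rightarrow> bool" where
  "wf_tm M \<longleftrightarrow>
     1 \<le> num_tapes M \<and> 4 \<le> num_symbols M \<and>
     start_state M < num_states M \<and> accept_state M < num_states M \<and>
     reject_state M < num_states M \<and> accept_state M \<noteq> reject_state M \<and>
     (\<forall>q ss. q < num_states M \<and> length ss = num_tapes M \<and> set ss \<subseteq> {..<num_symbols M} \<longrightarrow>
        (case transition M q ss of (q', acts) \<Rightarrow>
           q' < num_states M \<and> length acts = num_tapes M \<and>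
           (\<forall>(s, m)\<in>set acts. s < num_symbols M)))"

text \<open>A tape is infinite in both directions and is stored with its head position; a configuration
  is the current state and the list of tapes.\<close>

type_synonym tape = "(int \<Rightarrow> nat) \<times> int"
type_synonym config = "nat \<times> tape list"

fun read_tape :: "tape \<Rightarrow> nat" where
  "read_tape (c, h) = c h"

fun move_head :: "head_move \<Rightarrow> int \<Rightarrow> int" where
  "move_head Move_Left h = h - 1"
| "move_head Stay h = h"
| "move_head Move_Right h = h + 1"

fun act_tape :: "nat \<times> head_move \<Rightarrow> tape \<Rightarrow> tape" where
  "act_tape (s, m) (c, h) = (c(h := s), move_head m h)"

definition tm_step :: "turing_machine \<Rightarrow> config \<Rightarrow> config" where
  "tm_step M = (\<lambda>(q, ts).
     if q = accept_state M \<or> q = reject_state M then (q, ts)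
     else case transition M q (map read_tape ts) of (q', acts) \<Rightarrow> (q', map2 act_tape acts ts))"

definition blank_tape :: tape where
  "blank_tape = ((\<lambda>_. 0), 0)"

definition input_tape :: "nat list \<Rightarrow> tape" where
  "input_tape w = ((\<lambda>i. if 0 \<le> i \<and> i < int (length w) then w ! nat i else 0), 0)"

definition initial_config :: "turing_machine \<Rightarrow> nat list \<Rightarrow> config" where
  "initial_config M w = (start_state M, input_tape w # replicate (num_tapes M - 1) blank_tape)"

text \<open>On input \<open>w\<close>, the machine halts after at most \<open>T\<close> steps, and it accepts iff \<open>b\<close> holds.\<close>

definition answers_within :: "turing_machine \<Rightarrow> nat list \<Rightarrow> nat \<Rightarrow> bool \<Rightarrow> bool" where
  "answers_within M w T b \<longleftrightarrow>
     (\<exists>t\<le>T. fst ((tm_step M ^^ t) (initial_config M w)) =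
              (if b then accept_state M else reject_state M))"

section \<open>Pseudo-polynomial time\<close>

text \<open>Numbers are given to the machine in binary, most significant digit first.\<close>

fun binary_digits :: "nat \<Rightarrow> nat list" where
  "binary_digits n = (if n = 0 then [] else binary_digits (n div 2) @ [n mod 2])"

declare binary_digits.simps [simp del]

text \<open>On the tape, symbol \<open>1\<close> is the digit zero, symbol \<open>2\<close> is the digit one, and symbol \<open>3\<close>
  terminates each number.\<close>

definition encode :: "nat list \<Rightarrow> nat list" where
  "encode d = concat (map (\<lambda>x. map Suc (binary_digits x) @ [3]) d)"

text \<open>The problem of deciding \<open>P d\<close> for instances \<open>d \<in> I\<close> is solvable in pseudo-polynomial time:
  although \<open>d\<close> is encoded in binary, the running time is only required to be polynomial in the
  length of \<open>d\<close> and the numeric values of its entries.\<close>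

definition pseudo_polynomial_time_decidable :: "nat list set \<Rightarrow> (nat list \<Rightarrow> bool) \<Rightarrow> bool" where
  "pseudo_polynomial_time_decidable I P \<longleftrightarrow>
     (\<exists>M (p :: nat poly). wf_tm M \<and>
        (\<forall>d\<in>I. answers_within M (encode d) (poly p (length d + sum_list d)) (P d)))"

end

theory Submission
  imports Defs
begin

text \<open>
  In a bipartite multigraph each edge contributes one to the degree sum of either side, so the two
  sides split \<open>d\<close> into parts of equal sum. Conversely, an equal split is realized by repeatedly
  joining two vertices of positive residual degree on opposite sides, as parallel edges are allowed.
  The problem is thus to decide whether half of the total is a subset sum of \<open>d\<close>.

  A machine with three tapes does this by dynamic programming. The second and third tape both hold
  the characteristic vector of the subset sums of the numbers processed so far. The input is
  processed from its right end. The current number \<open>x\<close> is decremented in place down to \<open>0\<close>, and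
  each decrement appends one cell to the third tape, which leaves its head \<open>x\<close> cells ahead of the
  second one; a joint sweep to the left then adds all shifted sums. The underflow of the decrement
  leaves the input head on the terminator of the next number. In the end, the third head runs back
  at twice the speed of the second one, which therefore stops at the middle of the vector.
\<close>

section \<open>Balanced partitions\<close>

definition subset_sums :: "nat multiset \<Rightarrow> nat set" where
  "subset_sums X = {\<Sum>\<^sub># Y | Y. Y \<subseteq># X}"

lemma subset_sums_empty: "subset_sums {#} = {0}"
  by (auto simp: subset_sums_def)

text \<open>The recurrence of the dynamic program: a sub-multiset either uses the new copy of
  \<open>x\<close> or lies in \<open>X\<close>. One round of the machine performs exactly this
  update.\<close>

lemma subset_sums_add_mset:
  "subset_sums (add_mset x X) = subset_sums X \<union> (\<lambda>r. r + x) ` subset_sums X" (is "?L = ?R")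
proof
  show "?L \<subseteq> ?R"
  proof
    fix n assume "n \<in> ?L"
    then obtain Y where Y: "Y \<subseteq># add_mset x X" "n = \<Sum>\<^sub># Y"
      by (auto simp: subset_sums_def)
    show "n \<in> ?R"
    proof (cases "x \<in># Y")
      case True
      then obtain Z where Z: "Y = add_mset x Z" by (metis insert_DiffM)
      with Y have "Z \<subseteq># X" by simp
      then have "\<Sum>\<^sub># Z \<in> subset_sums X" by (auto simp: subset_sums_def)
      then show ?thesis using Y Z by auto
    next
      case False
      then have "Y \<subseteq># X" using Y(1) by (metis diff_single_trivial subset_eq_diff_conv add_mset_add_single)
      then show ?thesis using Y by (auto simp: subset_sums_def)
    qed
  qed
  show "?R \<subseteq> ?L"
  proof
    fix n assume "n \<in> ?R"
    then consider "n \<in> subset_sums X" | r where "r \<in> subset_sums X" "n = r + x" by auto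
    then show "n \<in> ?L"
    proof cases
      case 1
      then show ?thesis
        unfolding subset_sums_def using subset_mset.order_trans[OF _ mset_subset_eq_add_right[of X "{#x#}"]]
        by fastforce
    next
      case 2
      then obtain Y where "Y \<subseteq># X" "r = \<Sum>\<^sub># Y" by (auto simp: subset_sums_def)
      then have "add_mset x Y \<subseteq># add_mset x X" "n = \<Sum>\<^sub># (add_mset x Y)" using 2 by auto
      then show ?thesis unfolding subset_sums_def by blast
    qed
  qed
qed

lemma subset_sums_le: "n \<in> subset_sums X \<Longrightarrow> n \<le> \<Sum>\<^sub># X"
  by (auto simp: subset_sums_def subset_mset.le_iff_add)

section \<open>Degree sums and bipartite multigraphs with prescribed degrees\<close>

lemma mg_degree_add_mset:
  "mg_degree (add_mset e E) v = mg_degree E v + (if v \<in> e then 1 else 0)"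
  by (simp add: mg_degree_def)

text \<open>Double counting of incidences: every edge has exactly one endpoint in
  \<open>A\<close>.\<close>

lemma sum_mg_degree_side:
  assumes "finite A" "\<forall>e\<in>#E. card (A \<inter> e) = 1"
  shows "(\<Sum>v\<in>A. mg_degree E v) = size E"
  using assms(2)
proof (induction E)
  case empty
  then show ?case by (simp add: mg_degree_def)
next
  case (add e E)
  have "(\<Sum>v\<in>A. if v \<in> e then 1 else 0 :: nat) = card (A \<inter> e)"
    using assms(1) by (simp add: sum.If_cases)
  then show ?case using add by (simp add: mg_degree_add_mset sum.distrib)
qed

text \<open>Induction on the common sum. While it is positive, each side has a vertex of positive
  demand; lower both demands by one, realize the rest, and add the edge between the two. The same
  pair may be chosen again, which yields parallel edges.\<close>

lemma exists_bipartite_multigraph: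
  fixes f :: "'v \<Rightarrow> nat"
  assumes "finite A" "finite B" "A \<inter> B = {}" "sum f A = sum f B"
  shows "\<exists>E. (\<forall>e\<in>#E. \<exists>a\<in>A. \<exists>b\<in>B. e = {a, b}) \<and> (\<forall>v\<in>A \<union> B. mg_degree E v = f v)"
  using assms(4)
proof (induction "sum f A" arbitrary: f)
  case 0
  then have "\<forall>v\<in>A \<union> B. f v = 0" using assms by auto
  then show ?case by (intro exI[of _ "{#}"]) (auto simp: mg_degree_def)
next
  case (Suc n)
  have "sum f A \<noteq> 0" "sum f B \<noteq> 0" using Suc by auto
  then obtain a b where ab: "a \<in> A" "f a \<noteq> 0" "b \<in> B" "f b \<noteq> 0"
    by (metis sum.neutral)
  then have "a \<noteq> b" "b \<notin> A" "a \<notin> B" using assms(3) by auto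
  \<comment> \<open>Both values are nonzero, so the truncated subtraction is exact, and disjointness
    of the sides makes each side lose exactly one.\<close>
  let ?g = "f(a := f a - 1, b := f b - 1)"
  have "sum ?g A = sum f A - 1"
  proof -
    have "sum ?g A = (f a - 1) + sum ?g (A - {a})"
      using ab assms(1) \<open>a \<noteq> b\<close> by (subst sum.remove[of _ a]) auto
    moreover have "sum ?g (A - {a}) = sum f (A - {a})"
      using \<open>b \<notin> A\<close> by (intro sum.cong) auto
    ultimately show ?thesis using ab assms(1) by (simp add: sum.remove[of A a f])
  qed
  moreover have "sum ?g B = sum f B - 1"
  proof -
    have "sum ?g B = (f b - 1) + sum ?g (B - {b})"
      using ab assms(2) by (subst sum.remove[of _ b]) auto
    moreover have "sum ?g (B - {b}) = sum f (B - {b})"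
      using \<open>a \<notin> B\<close> by (intro sum.cong) auto
    ultimately show ?thesis using ab assms(2) by (simp add: sum.remove[of B b f])
  qed
  ultimately have "n = sum ?g A" "sum ?g A = sum ?g B" using Suc.hyps(2) Suc.prems by linarith+
  from Suc.hyps(1)[OF this] obtain E where E: "\<forall>e\<in>#E. \<exists>a\<in>A. \<exists>b\<in>B. e = {a, b}"
    "\<forall>v\<in>A \<union> B. mg_degree E v = ?g v"
    by blast
  show ?case
  proof (intro exI[of _ "add_mset {a, b} E"] conjI)
    show "\<forall>e\<in>#add_mset {a, b} E. \<exists>a\<in>A. \<exists>b\<in>B. e = {a, b}" using E(1) ab by auto
    show "\<forall>v\<in>A \<union> B. mg_degree (add_mset {a, b} E) v = f v"
      using E(2) ab \<open>a \<noteq> b\<close> by (auto simp: mg_degree_add_mset)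
  qed
qed

lemma mset_mg_degree_sequence:
  "mset (mg_degree_sequence V E) = image_mset (mg_degree E) (mset_set V)"
  by (simp add: mg_degree_sequence_def)

text \<open>Each side has degree sum \<open>size E\<close>, so the total is
  \<open>2 * size E\<close>, and the degrees on side \<open>A\<close> form the required
  sub-multiset.\<close>

lemma half_sum_if_realization:
  assumes "has_bipartite_multigraph_realization d"
  shows "sum_list d div 2 \<in> subset_sums (mset d)"
proof -
  obtain V :: "nat set" and E A B where G: "loopless_multigraph V E" "mg_degree_sequence V E = d"
    "A \<union> B = V" "A \<inter> B = {}" "\<forall>e\<in>#E. \<exists>a\<in>A. \<exists>b\<in>B. e = {a, b}"
    using assms by (auto simp: has_bipartite_multigraph_realization_def bipartite_def)
  have fin: "finite A" "finite B" using G by (auto simp: loopless_multigraph_def)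
  have md: "mset d = image_mset (mg_degree E) (mset_set A) + image_mset (mg_degree E) (mset_set B)"
    using mset_mg_degree_sequence[of V E] mset_set_Union[OF fin G(4)] by (simp add: G(2,3))
  have "card (A \<inter> e) = 1 \<and> card (B \<inter> e) = 1" if "e \<in># E" for e
  proof -
    from G(5) that obtain a b where "a \<in> A" "b \<in> B" "e = {a, b}" by (elim ballE bexE) auto
    then have "A \<inter> e = {a}" "B \<inter> e = {b}" using G(4) by fastforce+
    then show ?thesis by simp
  qed
  then have s: "(\<Sum>v\<in>A. mg_degree E v) = size E" "(\<Sum>v\<in>B. mg_degree E v) = size E"
    using fin by (simp_all add: sum_mg_degree_side)
  have "sum_list d = \<Sum>\<^sub># (mset d)" by (simp add: sum_mset_sum_list)
  also have "\<dots> = 2 * size E" unfolding md using s by (simp add: sum_unfold_sum_mset)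
  finally have "sum_list d = 2 * size E" .
  moreover have "image_mset (mg_degree E) (mset_set A) \<subseteq># mset d" by (simp add: md)
  then have "size E \<in> subset_sums (mset d)"
    unfolding subset_sums_def s(1)[symmetric] sum_unfold_sum_mset by blast
  ultimately show ?thesis by simp
qed

text \<open>The vertices are the positions in \<open>d\<close>, so equal entries remain
  distinguishable. The chosen half becomes one side, its complement the other.\<close>

lemma realization_if_half_sum:
  assumes d: "degree_sequence d" and half: "sum_list d div 2 \<in> subset_sums (mset d)"
  shows "has_bipartite_multigraph_realization d"
proof -
  obtain Y where Y: "Y \<subseteq># mset d" "\<Sum>\<^sub># Y = sum_list d div 2"
    using half by (auto simp: subset_sums_def)
  define V where "V = {..<length d}"
  have md: "mset d = image_mset ((!) d) (mset_set V)"
    by (metis V_def map_nth mset_map mset_upt lessThan_atLeast0)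
  \<comment> \<open>\<open>Y\<close> is lifted along \<open>(!) d\<close> to a multiset of
    positions. Inside \<open>mset_set V\<close> all multiplicities are at most one, so
    \<open>N\<close> is in fact a set.\<close>
  obtain N K where NK: "mset_set V = N + K" "Y = image_mset ((!) d) N"
    using Y(1) md by (metis image_mset_eq_plusD subset_mset.le_iff_add)
  define A where "A = set_mset N"
  have N: "N = mset_set A"
  proof (rule multiset_eqI)
    fix x
    have "count N x \<le> count (mset_set V) x" by (simp add: NK(1))
    also have "\<dots> \<le> 1" by (cases "x \<in> V") (simp_all add: V_def)
    finally have "count N x \<le> 1" .
    moreover have "x \<in> A \<longleftrightarrow> count N x > 0" by (simp add: A_def)
    ultimately show "count N x = count (mset_set A) x"
      by (cases "x \<in> A") (simp_all add: A_def del: count_greater_zero_iff)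
  qed
  have AV: "A \<subseteq> V"
    using arg_cong[OF NK(1), of set_mset] by (auto simp: A_def V_def)
  have fin: "finite V" "finite A" "finite (V - A)" by (auto simp: V_def A_def)
  have sA: "sum ((!) d) A = sum_list d div 2"
    using Y(2) NK(2) N by (simp add: sum_unfold_sum_mset)
  have "sum ((!) d) V = sum_list d"
    by (metis md sum_unfold_sum_mset sum_mset_sum_list)
  moreover have "sum ((!) d) V = sum ((!) d) A + sum ((!) d) (V - A)"
    using AV fin by (simp add: sum.subset_diff add.commute)
  \<comment> \<open>Evenness of the total is essential here: otherwise the complement would have sum
    one larger than \<open>A\<close>.\<close>
  ultimately have "sum ((!) d) A = sum ((!) d) (V - A)"
    using sA d by (auto simp: degree_sequence_def)
  then obtain E where E: "\<forall>e\<in>#E. \<exists>a\<in>A. \<exists>b\<in>V - A. e = {a, b}"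
    "\<forall>v\<in>A \<union> (V - A). mg_degree E v = d ! v"
    using exists_bipartite_multigraph[of A "V - A" "(!) d"] fin by auto
  have "image_mset (mg_degree E) (mset_set V) = mset d"
    unfolding md using E(2) fin by (intro image_mset_cong) auto
  \<comment> \<open>The multisets of degrees agree; monotonicity of \<open>d\<close> upgrades this
    to equality of lists.\<close>
  moreover have "sorted (rev d)" using d by (simp add: degree_sequence_def sorted_wrt_rev)
  ultimately have "mg_degree_sequence V E = d"
    unfolding mg_degree_sequence_def
    by (metis mset_rev properties_for_sort rev_rev_ident sorted_list_of_multiset_mset)
  moreover have "loopless_multigraph V E"
    unfolding loopless_multigraph_def
  proof (intro conjI ballI fin)
    fix e assume "e \<in># E"
    then obtain a b where "a \<in> A" "b \<in> V - A" "e = {a, b}" using E(1) by blast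
    then show "e \<subseteq> V" "card e = 2" using AV by (auto simp: card_2_iff)
  qed
  moreover have "bipartite V (set_mset E)"
    unfolding bipartite_def using AV E(1) by (intro exI[of _ A] exI[of _ "V - A"]) auto
  ultimately show ?thesis unfolding has_bipartite_multigraph_realization_def by blast
qed

section \<open>The machine\<close>

abbreviation (input) "Accept \<equiv> 0 :: nat"
abbreviation (input) "Reject \<equiv> 1 :: nat"
abbreviation (input) "Init \<equiv> 2 :: nat"
abbreviation (input) "Seek \<equiv> 3 :: nat"
abbreviation (input) "Dispatch \<equiv> 4 :: nat"
abbreviation (input) "Borrow \<equiv> 5 :: nat"
abbreviation (input) "Return \<equiv> 6 :: nat"
abbreviation (input) "Merge \<equiv> 7 :: nat"
abbreviation (input) "Rewind \<equiv> 8 :: nat"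
abbreviation (input) "Copy \<equiv> 9 :: nat"
abbreviation (input) "Check_Even \<equiv> 10 :: nat"
abbreviation (input) "Check_Odd \<equiv> 11 :: nat"

text \<open>On the input tape \<open>1\<close> and \<open>2\<close> are binary digits; on the other
  tapes they mark non-members and members. \<open>Init\<close> marks the empty sum 0. In
  \<open>Borrow\<close> a non-digit signals underflow. \<open>Merge\<close> is controlled by the
  second tape, \<open>Rewind\<close> and \<open>Copy\<close> by the third. The final branches belong
  to \<open>Check_Odd\<close>.\<close>

definition delta ::
  "nat \<Rightarrow> nat \<Rightarrow> nat \<Rightarrow> nat \<Rightarrow> nat \<times> (nat \<times> head_move) \<times> (nat \<times> head_move) \<times> (nat \<times> head_move)"
where
  "delta q a b c =
    (if q = Init then (Seek, (a, Stay), (2, Move_Right), (2, Move_Right))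
     else if q = Seek then
       (if a = 0 then (Dispatch, (a, Move_Left), (b, Stay), (c, Stay))
        else (Seek, (a, Move_Right), (b, Stay), (c, Stay)))
     else if q = Dispatch then
       (if a = 3 then (Borrow, (a, Move_Left), (b, Stay), (c, Stay))
        else (Check_Even, (a, Stay), (b, Move_Left), (c, Move_Left)))
     else if q = Borrow then
       (if a = 1 then (Borrow, (2, Move_Left), (b, Stay), (c, Stay))
        else if a = 2 then (Return, (1, Move_Right), (b, Stay), (1, Move_Right))
        else (Merge, (a, Stay), (b, Move_Left), (c, Move_Left)))
     else if q = Return then
       (if a = 3 then (Borrow, (a, Move_Left), (b, Stay), (c, Stay))
        else (Return, (a, Move_Right), (b, Stay), (c, Stay)))
     else if q = Merge then
       (if b = 0 then (Rewind, (a, Stay), (b, Stay), (c, Stay))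
        else (Merge, (a, Stay), (b, Move_Left), (if b = 2 then 2 else c, Move_Left)))
     else if q = Rewind then
       (if c = 0 then (Copy, (a, Stay), (b, Move_Right), (c, Move_Right))
        else (Rewind, (a, Stay), (b, Stay), (c, Move_Left)))
     else if q = Copy then
       (if c = 0 then (Dispatch, (a, Stay), (b, Stay), (c, Stay))
        else (Copy, (a, Stay), (c, Move_Right), (c, Move_Right)))
     else if q = Check_Even then (Check_Odd, (a, Stay), (b, Stay), (c, Move_Left))
     else if c = 0 then (if b = 2 then Accept else Reject, (a, Stay), (b, Stay), (c, Stay))
     else (Check_Even, (a, Stay), (b, Move_Left), (c, Move_Left)))"

definition partition_tm :: turing_machine where
  "partition_tm = \<lparr>num_tapes = 3, num_states = 12, num_symbols = 4, start_state = Init,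
     accept_state = Accept, reject_state = Reject,
     transition = (\<lambda>q ss. case delta q (ss ! 0) (ss ! 1) (ss ! 2) of
       (q', x, y, z) \<Rightarrow> (q', [x, y, z]))\<rparr>"

lemma wf_partition_tm: "wf_tm partition_tm"
proof -
  have delta: "case delta q a b c of (q', x, y, z) \<Rightarrow> q' < 12 \<and> fst x < 4 \<and> fst y < 4 \<and> fst z < 4"
    if "a < 4" "b < 4" "c < 4" for q a b c
    using that by (simp add: delta_def)
  have "case transition partition_tm q ss of (q', acts) \<Rightarrow>
      q' < 12 \<and> length acts = 3 \<and> (\<forall>(s, m)\<in>set acts. s < 4)"
    if "length ss = 3" "set ss \<subseteq> {..<4}" for q ss
  proof -
    obtain a b c where "ss = [a, b, c]"
      using \<open>length ss = 3\<close> by (auto simp: numeral_3_eq_3 length_Suc_conv)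
    then show ?thesis
      using that(2) delta[of a b c q] by (auto simp: partition_tm_def split: prod.splits)
  qed
  then show ?thesis
    unfolding wf_tm_def by (simp add: partition_tm_def)
qed

section \<open>Symbolic execution of the machine\<close>

lemma step_partition_tm:
  assumes "2 \<le> q"
  shows "tm_step partition_tm (q, [(f, i), (g, j), (h, k)]) =
    (case delta q (f i) (g j) (h k) of
       (q', x, y, z) \<Rightarrow> (q', [act_tape x (f, i), act_tape y (g, j), act_tape z (h, k)]))"
  using assms by (auto simp: tm_step_def partition_tm_def split: prod.splits)

text \<open>The time is only an upper bound, so that costs can be added and rounded up along a run;
  \<open>answers_within\<close> asks for no more.\<close>

definition reaches :: "config \<Rightarrow> nat \<Rightarrow> config \<Rightarrow> bool" where
  "reaches c t c' \<longleftrightarrow> (\<exists>k\<le>t. (tm_step partition_tm ^^ k) c = c')"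

lemma reaches_refl: "reaches c t c"
  unfolding reaches_def by (intro exI[of _ 0]) simp

lemma reaches_step:
  assumes "reaches (tm_step partition_tm c) t c'"
  shows "reaches c (Suc t) c'"
proof -
  obtain k where "k \<le> t" "(tm_step partition_tm ^^ k) (tm_step partition_tm c) = c'"
    using assms by (auto simp: reaches_def)
  then show ?thesis
    unfolding reaches_def by (intro exI[of _ "Suc k"]) (simp add: funpow_swap1)
qed

lemma reaches_trans:
  assumes "reaches c t c'" "reaches c' t' c''"
  shows "reaches c (t + t') c''"
proof -
  obtain k k' where "k \<le> t" "(tm_step partition_tm ^^ k) c = c'"
    "k' \<le> t'" "(tm_step partition_tm ^^ k') c' = c''"
    using assms by (auto simp: reaches_def)
  then show ?thesis
    unfolding reaches_def by (intro exI[of _ "k' + k"]) (simp add: funpow_add)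
qed

lemma reaches_mono: "reaches c t c' \<Longrightarrow> t \<le> t' \<Longrightarrow> reaches c t' c'"
  unfolding reaches_def using order_trans by blast

section \<open>Reading the input\<close>

text \<open>Here \<open>n\<close> counts the nonblank cells still ahead. On the first blank the head
  steps back to the last symbol; for empty input this is the blank cell before the origin.\<close>

lemma reaches_Seek:
  assumes "\<And>i. h \<le> i \<Longrightarrow> i < h + int n \<Longrightarrow> f i \<noteq> 0" "f (h + int n) = 0"
  shows "reaches (Seek, [(f, h), (a, i), (b, j)]) (Suc n)
           (Dispatch, [(f, h + int n - 1), (a, i), (b, j)])"
  using assms
proof (induction n arbitrary: h)
  case 0
  then show ?case
    by - (rule reaches_step, simp add: step_partition_tm delta_def reaches_refl fun_upd_idem)
next
  case (Suc n)
  have "f h \<noteq> 0" using Suc.prems(1)[of h] by simp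
  moreover have "reaches (Seek, [(f, h + 1), (a, i), (b, j)]) (Suc n)
           (Dispatch, [(f, h + 1 + int n - 1), (a, i), (b, j)])"
    using Suc.prems by (intro Suc.IH) (auto simp: algebra_simps)
  ultimately show ?case
    by - (rule reaches_step, simp add: step_partition_tm delta_def algebra_simps)
qed

section \<open>Binary counting on the input tape\<close>

fun bits_value :: "nat list \<Rightarrow> nat" where
  "bits_value [] = 0"
| "bits_value (b # bs) = b + 2 * bits_value bs"

text \<open>The digits \<open>bs\<close>, least significant first, are read leftwards from the cell before \<open>h\<close>.\<close>

fun digits_at :: "(int \<Rightarrow> nat) \<Rightarrow> int \<Rightarrow> nat list \<Rightarrow> bool" where
  "digits_at f h [] \<longleftrightarrow> True"
| "digits_at f h (b # bs) \<longleftrightarrow> b < 2 \<and> f (h - 1) = Suc b \<and> digits_at f (h - 1) bs"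

lemma digits_at_cong:
  "digits_at f h bs \<Longrightarrow> (\<And>i. h - int (length bs) \<le> i \<Longrightarrow> i < h \<Longrightarrow> f' i = f i) \<Longrightarrow> digits_at f' h bs"
  by (induction f h bs rule: digits_at.induct) auto

text \<open>Zeros are turned into ones up to the lowest one, which becomes zero; the head then
  returns to \<open>h\<close>. The turning point appends one cell to the third tape. The width is
  kept, leading zeros being allowed, so the process can be iterated.\<close>

lemma reaches_decrement:
  assumes "digits_at f h bs" "bits_value bs = Suc v"
  shows "\<exists>f' bs'. digits_at f' h bs' \<and> length bs' = length bs \<and> bits_value bs' = v \<and>
           (\<forall>i. i < h - int (length bs) \<or> h \<le> i \<longrightarrow> f' i = f i) \<and>
           reaches (Borrow, [(f, h - 1), (a, i), (b, j)]) (2 * length bs)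
             (Return, [(f', h), (a, i), (b(j := 1), j + 1)])"
  using assms
proof (induction bs arbitrary: f h v)
  case Nil
  then show ?case by simp
next
  case (Cons x bs)
  show ?case
  proof (cases "x = 0")
    case True
    \<comment> \<open>A borrow: \<open>2 * (w + 1) - 1 = 1 + 2 * w\<close>, so the higher digits are
      decremented to \<open>w\<close> and the lowest digit becomes one.\<close>
    then obtain w where w: "bits_value bs = Suc w" "v = Suc (2 * w)"
      using Cons.prems(2) by (cases "bits_value bs") auto
    let ?f = "f(h - 1 := 2)"
    have "digits_at ?f (h - 1) bs"
      using Cons.prems(1) by - (rule digits_at_cong[of f], auto)
    from Cons.IH[OF this w(1)] obtain f' bs' where IH: "digits_at f' (h - 1) bs'"
      "length bs' = length bs" "bits_value bs' = w"
      "\<forall>i. i < h - 1 - int (length bs) \<or> h - 1 \<le> i \<longrightarrow> f' i = ?f i"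
      "reaches (Borrow, [(?f, h - 1 - 1), (a, i), (b, j)]) (2 * length bs)
         (Return, [(f', h - 1), (a, i), (b(j := 1), j + 1)])"
      by blast
    have f': "f' (h - 1) = 2" using IH(4) by auto
    have "reaches (Return, [(f', h - 1), (a, i), (b(j := 1), j + 1)]) 1
      (Return, [(f', h), (a, i), (b(j := 1), j + 1)])"
      unfolding One_nat_def using f'
      by - (rule reaches_step, simp add: step_partition_tm delta_def reaches_refl fun_upd_idem)
    with IH(5) have "reaches (Borrow, [(?f, h - 1 - 1), (a, i), (b, j)]) (2 * length bs + 1)
         (Return, [(f', h), (a, i), (b(j := 1), j + 1)])"
      by (rule reaches_trans)
    then have "reaches (Borrow, [(f, h - 1), (a, i), (b, j)]) (Suc (2 * length bs + 1))
         (Return, [(f', h), (a, i), (b(j := 1), j + 1)])" (is "reaches _ ?t _")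
      using Cons.prems(1) True by - (rule reaches_step, simp add: step_partition_tm delta_def)
    moreover have "?t = 2 * length (x # bs)" by simp
    moreover have "\<forall>i. i < h - int (length (x # bs)) \<or> h \<le> i \<longrightarrow> f' i = f i"
      using IH(4) by auto
    moreover have "digits_at f' h (1 # bs')" "length (1 # bs') = length (x # bs)"
      "bits_value (1 # bs') = v"
      using IH(1-3) w f' by simp_all
    ultimately show ?thesis by metis
  next
    case False
    then have x: "x = 1" "f (h - 1) = 2" using Cons.prems(1) by auto
    let ?f = "f(h - 1 := 1)"
    have "digits_at ?f (h - 1) bs"
      using Cons.prems(1) by - (rule digits_at_cong[of f], auto)
    moreover have "reaches (Borrow, [(f, h - 1), (a, i), (b, j)]) (Suc 1)
         (Return, [(?f, h), (a, i), (b(j := 1), j + 1)])"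
      using x by - (rule reaches_step, simp add: step_partition_tm delta_def reaches_refl)
    then have "reaches (Borrow, [(f, h - 1), (a, i), (b, j)]) (2 * length (x # bs))
         (Return, [(?f, h), (a, i), (b(j := 1), j + 1)])"
      by (rule reaches_mono) simp
    moreover have "\<forall>i. i < h - int (length (x # bs)) \<or> h \<le> i \<longrightarrow> ?f i = f i" by simp
    moreover have "?f (h - 1) = Suc 0" by simp
    then have "digits_at ?f h (0 # bs)" if "digits_at ?f (h - 1) bs"
      using that by (simp del: fun_upd_apply)
    moreover have "length (0 # bs) = length (x # bs)" "bits_value (0 # bs) = v"
      using x Cons.prems(2) by simp_all
    ultimately show ?thesis by metis
  qed
qed

text \<open>With only zeros left, the borrow runs through the whole number and stops at the first
  non-digit, the terminator of the next number or the blank before the input. The digits are spoilt,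
  hence \<open>f'\<close> is described only to their left.\<close>

lemma reaches_underflow:
  assumes "digits_at f h bs" "bits_value bs = 0" "f (h - 1 - int (length bs)) \<in> {0, 3}"
  shows "\<exists>f'. (\<forall>i. i < h - int (length bs) \<longrightarrow> f' i = f i) \<and>
           reaches (Borrow, [(f, h - 1), (a, i), (b, j)]) (Suc (length bs))
             (Merge, [(f', h - 1 - int (length bs)), (a, i - 1), (b, j - 1)])"
  using assms
proof (induction bs arbitrary: f h)
  case Nil
  then have "reaches (Borrow, [(f, h - 1), (a, i), (b, j)]) (Suc 0)
     (Merge, [(f, h - 1), (a, i - 1), (b, j - 1)])"
    by - (rule reaches_step, auto simp add: step_partition_tm delta_def reaches_refl)
  then show ?case by (intro exI[of _ f]) auto
next
  case (Cons x bs)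
  let ?f = "f(h - 1 := 2)"
  have "digits_at ?f (h - 1) bs"
    using Cons.prems(1) by - (rule digits_at_cong[of f], auto)
  moreover have "?f (h - 1 - 1 - int (length bs)) \<in> {0, 3}"
    using Cons.prems(3) by (simp add: algebra_simps)
  moreover have "bits_value bs = 0" using Cons.prems(2) by simp
  ultimately obtain f' where f': "\<forall>i. i < h - 1 - int (length bs) \<longrightarrow> f' i = ?f i"
    "reaches (Borrow, [(?f, h - 1 - 1), (a, i), (b, j)]) (Suc (length bs))
       (Merge, [(f', h - 1 - 1 - int (length bs)), (a, i - 1), (b, j - 1)])"
    using Cons.IH[of ?f "h - 1"] by metis
  have "reaches (Borrow, [(f, h - 1), (a, i), (b, j)]) (Suc (Suc (length bs)))
       (Merge, [(f', h - 1 - 1 - int (length bs)), (a, i - 1), (b, j - 1)])"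
    using Cons.prems f'(2) by - (rule reaches_step, simp add: step_partition_tm delta_def)
  then show ?case using f'(1) by (intro exI[of _ f']) (simp add: algebra_simps)
qed

text \<open>Decrementing \<open>v\<close> times and then underflowing turns the binary value into a
  distance: the third head advances by \<open>v\<close> while the second stays. Both finally step
  left once, onto the last cell written before them.\<close>

lemma reaches_count_down:
  assumes "digits_at f h bs" "bits_value bs = v" "f h = 3" "f (h - 1 - int (length bs)) \<in> {0, 3}"
  shows "\<exists>f'. (\<forall>i. i < h - int (length bs) \<longrightarrow> f' i = f i) \<and>
           reaches (Borrow, [(f, h - 1), (a, i), (b, j)])
             (v * (2 * length bs + 1) + Suc (length bs))
             (Merge, [(f', h - 1 - int (length bs)), (a, i - 1),
               ((\<lambda>k. if j \<le> k \<and> k < j + int v then 1 else b k), j + int v - 1)])"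
  using assms
proof (induction v arbitrary: f bs b j)
  case 0
  have "(\<lambda>k. if j \<le> k \<and> k < j + int 0 then 1 else b k) = b" by auto
  with 0 show ?case using reaches_underflow[of f h bs a i b j] by (simp del: insert_iff)
next
  case (Suc v)
  obtain f1 bs1 where 1: "digits_at f1 h bs1" "length bs1 = length bs" "bits_value bs1 = v"
    "\<forall>i. i < h - int (length bs) \<or> h \<le> i \<longrightarrow> f1 i = f i"
    "reaches (Borrow, [(f, h - 1), (a, i), (b, j)]) (2 * length bs)
       (Return, [(f1, h), (a, i), (b(j := 1), j + 1)])"
    using reaches_decrement[OF Suc.prems(1,2)] by blast
  have f1: "f1 h = 3" "f1 (h - 1 - int (length bs)) \<in> {0, 3}"
    using 1(4) Suc.prems(3,4) by auto
  obtain f2 where 2: "\<forall>i. i < h - int (length bs) \<longrightarrow> f2 i = f1 i"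
    "reaches (Borrow, [(f1, h - 1), (a, i), (b(j := 1), j + 1)])
       (v * (2 * length bs + 1) + Suc (length bs))
       (Merge, [(f2, h - 1 - int (length bs)), (a, i - 1),
         ((\<lambda>k. if j + 1 \<le> k \<and> k < j + 1 + int v then 1 else (b(j := 1)) k), j + 1 + int v - 1)])"
    using Suc.IH[OF 1(1,3) f1(1), unfolded 1(2), OF f1(2)] by blast
  have "(\<lambda>k. if j + 1 \<le> k \<and> k < j + 1 + int v then 1 else (b(j := 1)) k) =
        (\<lambda>k. if j \<le> k \<and> k < j + int (Suc v) then 1 else b k)"
    by (intro ext) auto
  with 2(2) have 3: "reaches (Borrow, [(f1, h - 1), (a, i), (b(j := 1), j + 1)])
       (v * (2 * length bs + 1) + Suc (length bs))
       (Merge, [(f2, h - 1 - int (length bs)), (a, i - 1),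
         ((\<lambda>k. if j \<le> k \<and> k < j + int (Suc v) then 1 else b k), j + int (Suc v) - 1)])"
    by (simp add: algebra_simps)
  \<comment> \<open>Reading the terminator at \<open>h\<close> restarts the borrow; this is the
    \<open>+ 1\<close> in the cost of each decrement.\<close>
  have "reaches (Return, [(f1, h), (a, i), (b(j := 1), j + 1)])
       (Suc (v * (2 * length bs + 1) + Suc (length bs)))
       (Merge, [(f2, h - 1 - int (length bs)), (a, i - 1),
         ((\<lambda>k. if j \<le> k \<and> k < j + int (Suc v) then 1 else b k), j + int (Suc v) - 1)])"
    using 3 f1(1) by - (rule reaches_step, simp add: step_partition_tm delta_def fun_upd_idem)
  from reaches_trans[OF 1(5) this] show ?case
    using 1(4) 2(1) by (intro exI[of _ f2] conjI) (auto simp: algebra_simps elim: reaches_mono)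
qed

section \<open>Updating the table of subset sums\<close>

text \<open>Symbol \<open>2\<close> marks the members of \<open>R\<close> among \<open>0, \<dots>, s\<close>; the blanks around delimit the table.\<close>

definition table :: "nat set \<Rightarrow> nat \<Rightarrow> int \<Rightarrow> nat" where
  "table R s i = (if 0 \<le> i \<and> i \<le> int s then if nat i \<in> R then 2 else 1 else 0)"

text \<open>The cells appended while counting down are non-members of \<open>R\<close>, so they
  merely lengthen the table.\<close>

lemma table_extend:
  assumes "R \<subseteq> {..s}"
  shows "(\<lambda>k. if int s + 1 \<le> k \<and> k < int s + 1 + int x then 1 else table R s k) = table R (s + x)"
  using assms by (intro ext) (auto simp: table_def)

text \<open>Invariant of the leftward sweep: the sums \<open>r + x\<close> with
  \<open>n \<le> r\<close> have been entered. Membership is read from the old copy on the second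
  tape, so \<open>x\<close> is added at most once to each sum.\<close>

lemma reaches_Merge:
  assumes "n \<le> Suc s"
  shows "reaches (Merge, [(f, h), (table R s, int n - 1),
             (table (R \<union> (\<lambda>r. r + x) ` {r \<in> R. n \<le> r}) (s + x), int n - 1 + int x)]) (Suc n)
           (Rewind, [(f, h), (table R s, -1), (table (R \<union> (\<lambda>r. r + x) ` R) (s + x), int x - 1)])"
  using assms
proof (induction n)
  case 0
  have "{r \<in> R. 0 \<le> r} = R" by auto
  moreover have "table R s (-1) = 0" by (simp add: table_def)
  ultimately show ?case
    by - (rule reaches_step, simp add: step_partition_tm delta_def reaches_refl fun_upd_idem)
next
  case (Suc n)
  let ?T = "\<lambda>n. table (R \<union> (\<lambda>r. r + x) ` {r \<in> R. n \<le> r}) (s + x)"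
  have a: "table R s (int n) = (if n \<in> R then 2 else 1)" using Suc.prems by (simp add: table_def)
  \<comment> \<open>Lowering the threshold from \<open>Suc n\<close> to \<open>n\<close> can only
    add the shifted sum \<open>n + x\<close>, so a single cell is affected.\<close>
  have b: "(?T (Suc n))(int n + int x := if n \<in> R then 2 else ?T (Suc n) (int n + int x)) = ?T n"
  proof
    fix i
    show "((?T (Suc n))(int n + int x := if n \<in> R then 2 else ?T (Suc n) (int n + int x))) i = ?T n i"
    proof (cases "i = int n + int x")
      case True
      then have "nat i = n + x" by simp
      then show ?thesis using Suc.prems True by (auto simp: table_def Suc_le_eq)
    next
      case False
      then have "nat i \<in> (\<lambda>r. r + x) ` {r \<in> R. n \<le> r} \<longleftrightarrow>
          nat i \<in> (\<lambda>r. r + x) ` {r \<in> R. Suc n \<le> r}" if "0 \<le> i"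
        using that by (auto simp: Suc_le_eq image_iff le_less)
      then show ?thesis using False by (auto simp: table_def)
    qed
  qed
  have "reaches (Merge, [(f, h), (table R s, int n - 1), (?T n, int n - 1 + int x)]) (Suc n)
      (Rewind, [(f, h), (table R s, -1), (table (R \<union> (\<lambda>r. r + x) ` R) (s + x), int x - 1)])"
    using Suc by simp
  moreover have "tm_step partition_tm
      (Merge, [(f, h), (table R s, int (Suc n) - 1), (?T (Suc n), int (Suc n) - 1 + int x)]) =
      (Merge, [(f, h), (table R s, int n - 1), (?T n, int n - 1 + int x)])"
    using a b by (simp add: step_partition_tm delta_def fun_upd_idem split: if_splits)
  ultimately show ?case by - (rule reaches_step, simp)
qed

lemma reaches_Rewind:
  assumes "n \<le> Suc s"
  shows "reaches (Rewind, [(f, h), (a, -1), (table R s, int n - 1)]) (Suc n)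
           (Copy, [(f, h), (a, 0), (table R s, 0)])"
  using assms
proof (induction n)
  case 0
  have "table R s (-1) = 0" by (simp add: table_def)
  then show ?case
    by - (rule reaches_step, simp add: step_partition_tm delta_def reaches_refl fun_upd_idem)
next
  case (Suc n)
  have "table R s (int n) \<noteq> 0" using Suc.prems by (simp add: table_def)
  then show ?case
    using Suc by - (rule reaches_step, simp add: step_partition_tm delta_def fun_upd_idem)
qed

text \<open>The last \<open>n\<close> cells up to \<open>s\<close> are still to be copied; outside
  them the second tape already agrees with the table.\<close>

lemma reaches_Copy:
  assumes "n \<le> Suc s" "\<And>i. i < int (Suc s - n) \<or> int s < i \<Longrightarrow> a i = table R s i"
  shows "reaches (Copy, [(f, h), (a, int (Suc s - n)), (table R s, int (Suc s - n))]) (Suc n)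
           (Dispatch, [(f, h), (table R s, int s + 1), (table R s, int s + 1)])"
  using assms
proof (induction n arbitrary: a)
  case 0
  then have "a = table R s" by (intro ext) force
  moreover have "table R s (int s + 1) = 0" by (simp add: table_def)
  ultimately show ?case
    by - (rule reaches_step, simp add: step_partition_tm delta_def reaches_refl fun_upd_idem add.commute)
next
  case (Suc n)
  let ?k = "int (s - n)"
  let ?a = "a(?k := table R s ?k)"
  have "reaches (Copy, [(f, h), (?a, int (Suc s - n)), (table R s, int (Suc s - n))]) (Suc n)
      (Dispatch, [(f, h), (table R s, int s + 1), (table R s, int s + 1)])"
    using Suc.prems by (intro Suc.IH) auto
  moreover have "int (Suc s - n) = ?k + 1" using Suc.prems(1) by simp
  moreover have "table R s ?k \<noteq> 0" by (simp add: table_def)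
  ultimately show ?case
    by - (rule reaches_step, simp add: step_partition_tm delta_def fun_upd_idem)
qed

text \<open>\<open>L\<close> bounds both the number of digits and the table size. Counting down
  costs a quadratic number of steps, all other phases a linear one.\<close>

lemma reaches_round:
  assumes "digits_at f h bs" "bits_value bs = x" "f h = 3" "f (h - 1 - int (length bs)) \<in> {0, 3}"
    and "R \<subseteq> {..s}" and "length bs \<le> L" "s + x \<le> L"
  shows "\<exists>f'. (\<forall>i. i < h - int (length bs) \<longrightarrow> f' i = f i) \<and>
           reaches (Dispatch, [(f, h), (table R s, int s + 1), (table R s, int s + 1)])
             (8 * (L + 1)\<^sup>2)
             (Dispatch, [(f', h - 1 - int (length bs)),
                (table (R \<union> (\<lambda>r. r + x) ` R) (s + x), int (s + x) + 1),
                (table (R \<union> (\<lambda>r. r + x) ` R) (s + x), int (s + x) + 1)])"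
proof -
  let ?R = "R \<union> (\<lambda>r. r + x) ` R"
  obtain f' where f': "\<forall>i. i < h - int (length bs) \<longrightarrow> f' i = f i"
    and r2: "reaches (Borrow, [(f, h - 1), (table R s, int s + 1), (table R s, int s + 1)])
       (x * (2 * length bs + 1) + Suc (length bs))
       (Merge, [(f', h - 1 - int (length bs)), (table R s, int s + 1 - 1),
         (table R (s + x), int s + 1 + int x - 1)])"
    using reaches_count_down[OF assms(1-4), of "table R s" "int s + 1" "table R s" "int s + 1"]
    unfolding table_extend[OF assms(5)] by blast
  let ?h = "h - 1 - int (length bs)"
  have "reaches (Dispatch, [(f, h), (table R s, int s + 1), (table R s, int s + 1)]) (Suc 0)
     (Borrow, [(f, h - 1), (table R s, int s + 1), (table R s, int s + 1)])"
    using assms(3)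
    by - (rule reaches_step, simp add: step_partition_tm delta_def reaches_refl fun_upd_idem)
  note r = reaches_trans[OF this r2]
  \<comment> \<open>Initially no shifted sum has been entered, which is the invariant of the sweep
    for the threshold \<open>Suc s\<close>.\<close>
  have "R \<union> (\<lambda>r. r + x) ` {r \<in> R. Suc s \<le> r} = R" using assms(5) by auto
  then have "reaches (Merge, [(f', ?h), (table R s, int s + 1 - 1),
         (table R (s + x), int s + 1 + int x - 1)]) (Suc (Suc s))
       (Rewind, [(f', ?h), (table R s, -1), (table ?R (s + x), int x - 1)])"
    using reaches_Merge[of "Suc s" s f' ?h R x] by (simp add: algebra_simps)
  note r = reaches_trans[OF r this]
  have "reaches (Rewind, [(f', ?h), (table R s, -1), (table ?R (s + x), int x - 1)]) (Suc x)
     (Copy, [(f', ?h), (table R s, 0), (table ?R (s + x), 0)])"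
    by (intro reaches_Rewind) simp
  note r = reaches_trans[OF r this]
  \<comment> \<open>Both tables are blank outside cells \<open>0\<close> to \<open>s + x\<close>, so
    copying these cells makes the tapes equal.\<close>
  have "reaches (Copy, [(f', ?h), (table R s, 0), (table ?R (s + x), 0)]) (Suc (Suc (s + x)))
     (Dispatch, [(f', ?h), (table ?R (s + x), int (s + x) + 1), (table ?R (s + x), int (s + x) + 1)])"
    using reaches_Copy[of "Suc (s + x)" "s + x" "table R s" ?R f' ?h, OF order_refl]
    by (force simp: table_def[of _ _ i for i])
  note r = reaches_trans[OF r this]
  have "x * (2 * length bs + 1) \<le> L * (2 * L + 1)"
    using assms by (intro mult_mono) auto
  then have "Suc 0 + (x * (2 * length bs + 1) + Suc (length bs)) + Suc (Suc s) + Suc x +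
      Suc (Suc (s + x)) \<le> 8 * (L + 1)\<^sup>2"
    using assms(6,7) by (simp add: power2_eq_square algebra_simps)
  from reaches_mono[OF r this] f' show ?thesis by blast
qed

section \<open>Correctness and running time\<close>

text \<open>The numbers are listed from right to left, as the machine meets them, with
  \<open>h\<close> on the terminator of the next one.\<close>

fun numbers_at :: "(int \<Rightarrow> nat) \<Rightarrow> int \<Rightarrow> nat list list \<Rightarrow> bool" where
  "numbers_at f h [] \<longleftrightarrow> f h = 0"
| "numbers_at f h (bs # bss) \<longleftrightarrow>
     f h = 3 \<and> digits_at f h bs \<and> numbers_at f (h - 1 - int (length bs)) bss"

lemma numbers_at_cong:
  "numbers_at f h bss \<Longrightarrow> (\<And>i. i \<le> h \<Longrightarrow> f' i = f i) \<Longrightarrow> numbers_at f' h bss"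
  by (induction f h bss rule: numbers_at.induct) (auto intro: digits_at_cong)

lemma numbers_at_head: "numbers_at f h bss \<Longrightarrow> f h \<in> {0, 3}"
  by (cases bss) auto

text \<open>\<open>X\<close> collects the numbers already processed. A round alters the input tape
  only at or to the right of its number's digits, so the numbers still to come are intact;
  \<open>L\<close> bounds the final total and hence every intermediate one.\<close>

lemma reaches_all_rounds:
  assumes "numbers_at f h bss" "\<Sum>\<^sub># X + sum_list (map bits_value bss) \<le> L"
    and "\<And>bs. bs \<in> set bss \<Longrightarrow> length bs \<le> L"
  defines "conf \<equiv> \<lambda>f h Y. (Dispatch, [(f, h),
      (table (subset_sums Y) (\<Sum>\<^sub># Y), int (\<Sum>\<^sub># Y) + 1),
      (table (subset_sums Y) (\<Sum>\<^sub># Y), int (\<Sum>\<^sub># Y) + 1)])"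
  shows "\<exists>f' h'. f' h' = 0 \<and>
    reaches (conf f h X) (length bss * (8 * (L + 1)\<^sup>2)) (conf f' h' (X + mset (map bits_value bss)))"
  using assms(1-3)
proof (induction bss arbitrary: f h X)
  case Nil
  then show ?case by (intro exI[of _ f] exI[of _ h]) (simp add: reaches_refl)
next
  case (Cons bs bss)
  let ?h = "h - 1 - int (length bs)" and ?X = "add_mset (bits_value bs) X"
  have bs: "digits_at f h bs" "f h = 3" "numbers_at f ?h bss" "f ?h \<in> {0, 3}"
    using Cons.prems(1) numbers_at_head by auto
  have sums: "subset_sums X \<subseteq> {..\<Sum>\<^sub># X}" using subset_sums_le by auto
  have L: "length bs \<le> L" "\<Sum>\<^sub># X + bits_value bs \<le> L" using Cons.prems(2,3) by auto
  obtain f1 where f1: "\<forall>i. i < h - int (length bs) \<longrightarrow> f1 i = f i"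
    "reaches (conf f h X) (8 * (L + 1)\<^sup>2) (conf f1 ?h ?X)"
    using reaches_round[OF bs(1) refl bs(2,4) sums L]
    unfolding conf_def subset_sums_add_mset sum_mset.add_mset
    by (auto simp: add.commute)
  have "numbers_at f1 ?h bss" using f1(1) by (intro numbers_at_cong[OF bs(3)]) auto
  then obtain f' h' where f': "f' h' = 0" "reaches (conf f1 ?h ?X) (length bss * (8 * (L + 1)\<^sup>2))
      (conf f' h' (?X + mset (map bits_value bss)))"
    using Cons.IH[of f1 ?h ?X] Cons.prems(2,3) by (auto simp: add_ac)
  show ?case using reaches_trans[OF f1(2) f'(2)] f'(1) by auto
qed

text \<open>The invariant positions \<open>m + n\<close> and \<open>2 * n\<close> express the double
  speed. The table has \<open>2 * m + 1\<close> cells, so the third head leaves it in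
  \<open>Check_Odd\<close>, just when the second is at \<open>m\<close>.\<close>

lemma reaches_Check:
  assumes "n \<le> m"
  shows "\<exists>ts. reaches (Check_Even, [(f, h), (table R (2 * m), int (m + n)),
      (table R (2 * m), int (2 * n))]) (2 * n + 2) (if m \<in> R then Accept else Reject, ts)"
  using assms
proof (induction n)
  case 0
  have t: "table R (2 * m) (int m) = (if m \<in> R then 2 else 1)" "table R (2 * m) (-1) = 0"
    by (simp_all add: table_def)
  have "reaches (Check_Odd, [(f, h), (table R (2 * m), int m), (table R (2 * m), -1)]) (Suc 0)
      (if m \<in> R then Accept else Reject,
        [(f, h), (table R (2 * m), int m), (table R (2 * m), -1)])"
    using t by - (rule reaches_step, simp add: step_partition_tm delta_def reaches_refl fun_upd_idem)
  then have "reaches (Check_Even, [(f, h), (table R (2 * m), int m), (table R (2 * m), 0)])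
      (Suc (Suc 0)) (if m \<in> R then Accept else Reject,
        [(f, h), (table R (2 * m), int m), (table R (2 * m), -1)])"
    by - (rule reaches_step, simp add: step_partition_tm delta_def)
  then show ?case by (auto simp: numeral_2_eq_2)
next
  case (Suc n)
  obtain ts where ts: "reaches (Check_Even, [(f, h), (table R (2 * m), int (m + n)),
      (table R (2 * m), int (2 * n))]) (2 * n + 2) (if m \<in> R then Accept else Reject, ts)"
    using Suc by auto
  have "table R (2 * m) (2 * int n + 1) \<noteq> 0" using Suc.prems by (simp add: table_def)
  then have "reaches (Check_Odd, [(f, h), (table R (2 * m), int (m + Suc n)),
      (table R (2 * m), int (2 * Suc n) - 1)]) (Suc (2 * n + 2)) (if m \<in> R then Accept else Reject, ts)"
    using ts by - (rule reaches_step, simp add: step_partition_tm delta_def add.commute)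
  then have "reaches (Check_Even, [(f, h), (table R (2 * m), int (m + Suc n)),
      (table R (2 * m), int (2 * Suc n))]) (Suc (Suc (2 * n + 2)))
      (if m \<in> R then Accept else Reject, ts)"
    by - (rule reaches_step, simp add: step_partition_tm delta_def del: of_nat_Suc of_nat_mult of_nat_add)
  then show ?case by auto
qed

section \<open>The encoded input on the tape\<close>

lemma binary_digits_less_2: "b \<in> set (binary_digits n) \<Longrightarrow> b < 2"
proof (induction n rule: binary_digits.induct)
  case (1 n)
  then show ?case by (cases "n = 0") (auto simp: binary_digits.simps[of n] binary_digits.simps[of 0])
qed

lemma bits_value_binary_digits: "bits_value (rev (binary_digits n)) = n"
proof (induction n rule: binary_digits.induct)
  case (1 n)
  then show ?case by (cases "n = 0") (auto simp: binary_digits.simps[of n] binary_digits.simps[of 0])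
qed

text \<open>A bound in the numeric value, the measure used for pseudo-polynomial time.\<close>

lemma length_binary_digits_le: "length (binary_digits n) \<le> n"
proof (induction n rule: binary_digits.induct)
  case (1 n)
  then show ?case by (cases "n = 0") (auto simp: binary_digits.simps[of n] binary_digits.simps[of 0])
qed

lemma input_tape_nth:
  "i < length w \<Longrightarrow> fst (input_tape w) (int i) = w ! i"
  by (simp add: input_tape_def)

text \<open>The most significant digit comes first on the tape, hence \<open>rev\<close>. The suffix
  \<open>z\<close> absorbs the last digit in the reverse induction.\<close>

lemma digits_at_input_tape:
  assumes "\<forall>b\<in>set bs. b < 2"
  shows "digits_at (fst (input_tape (u @ map Suc bs @ z))) (int (length u + length bs)) (rev bs)"
  using assms
proof (induction bs arbitrary: z rule: rev_induct)
  case Nil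
  then show ?case by simp
next
  case (snoc b bs)
  have "int (length u + length (bs @ [b])) - 1 = int (length u + length bs)" by simp
  moreover have "fst (input_tape (u @ map Suc (bs @ [b]) @ z)) (int (length u + length bs)) = Suc b"
    by (subst input_tape_nth) (auto simp: nth_append)
  ultimately show ?case using snoc.IH[of "Suc b # z"] snoc.prems by auto
qed

text \<open>Reverse induction follows the machine's right-to-left order, the suffix \<open>z\<close>
  holding the numbers already split off. For empty \<open>d\<close> the head position is
  \<open>-1\<close>, a blank cell.\<close>

lemma numbers_at_input_tape:
  "numbers_at (fst (input_tape (encode d @ z))) (int (length (encode d)) - 1)
     (map (\<lambda>x. rev (binary_digits x)) (rev d))"
proof (induction d arbitrary: z rule: rev_induct)
  case Nil
  then show ?case by (simp add: encode_def input_tape_def)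
next
  case (snoc x d)
  let ?bs = "binary_digits x"
  let ?f = "fst (input_tape (encode (d @ [x]) @ z))" and ?h = "int (length (encode d) + length ?bs)"
  have e: "encode (d @ [x]) @ z = encode d @ map Suc ?bs @ 3 # z" by (simp add: encode_def)
  have "int (length (encode (d @ [x]))) - 1 = ?h" by (simp add: encode_def)
  moreover have "?f ?h = 3"
    unfolding e by (subst input_tape_nth) (auto simp: nth_append)
  moreover have "digits_at ?f ?h (rev ?bs)"
    unfolding e using digits_at_input_tape binary_digits_less_2 by blast
  moreover have "numbers_at ?f (?h - 1 - int (length (rev ?bs)))
      (map (\<lambda>x. rev (binary_digits x)) (rev d))"
    using snoc[of "map Suc ?bs @ 3 # z"] unfolding e by (simp add: algebra_simps)
  ultimately show ?case by simp
qed

lemma length_encode_le: "length (encode d) \<le> length d + sum_list d"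
proof (induction d)
  case (Cons x d)
  then show ?case using length_binary_digits_le[of x] by (simp add: encode_def)
qed (simp add: encode_def)

lemma encode_nonzero: "c \<in> set (encode d) \<Longrightarrow> c \<noteq> 0"
  by (auto simp: encode_def split: if_splits)

text \<open>At most \<open>L\<close> rounds of quadratic cost give the cubic bound; initialization,
  seeking and the final check are linear.\<close>

lemma partition_tm_answers:
  assumes "even (sum_list d)"
  shows "answers_within partition_tm (encode d) (16 * (length d + sum_list d + 1) ^ 3)
           (sum_list d div 2 \<in> subset_sums (mset d))"
proof -
  define L where "L = length d + sum_list d"
  define w where "w = encode d"
  define f where "f = fst (input_tape w)"
  let ?bss = "map (\<lambda>x. rev (binary_digits x)) (rev d)"
  obtain m where m: "sum_list d = 2 * m" using assms by (elim evenE)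
  let ?b = "(table {0} 0, 1 :: int)"
  have "(\<lambda>_. 0)(0 := 2) = table {0} 0" by (intro ext) (auto simp: table_def)
  moreover have "initial_config partition_tm w =
      (Init, [(f, 0), (\<lambda>_. 0, 0), (\<lambda>_. 0, 0)])"
    by (simp add: initial_config_def partition_tm_def blank_tape_def f_def input_tape_def
        numeral_2_eq_2)
  ultimately have "reaches (initial_config partition_tm w) (Suc 0) (Seek, [(f, 0), ?b, ?b])"
    by - (rule reaches_step, simp add: step_partition_tm delta_def reaches_refl)
  moreover have "reaches (Seek, [(f, 0), ?b, ?b]) (Suc (length w))
      (Dispatch, [(f, int (length w) - 1), ?b, ?b])"
  proof -
    have "f i \<noteq> 0" if "0 \<le> i" "i < int (length w)" for i
    proof -
      have "w ! nat i \<in> set w" using that by simp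
      then show ?thesis using that encode_nonzero[of "w ! nat i" d] by (simp add: f_def input_tape_def w_def)
    qed
    then show ?thesis using reaches_Seek[of 0 "length w" f] by (simp add: f_def input_tape_def)
  qed
  ultimately have r: "reaches (initial_config partition_tm w) (Suc 0 + Suc (length w))
      (Dispatch, [(f, int (length w) - 1), ?b, ?b])"
    by (rule reaches_trans)
  have num: "numbers_at f (int (length w) - 1) ?bss"
    using numbers_at_input_tape[of d "[]"] by (simp add: f_def w_def)
  have vals: "map bits_value ?bss = rev d"
    by (simp add: o_def bits_value_binary_digits)
  have len: "length bs \<le> L" if "bs \<in> set ?bss" for bs
  proof -
    obtain x where "x \<in> set d" "bs = rev (binary_digits x)" using \<open>bs \<in> set ?bss\<close> by auto
    then show ?thesis
      using length_binary_digits_le[of x] member_le_sum_list[of x d] by (simp add: L_def)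
  qed
  obtain f' h' where f': "f' h' = 0"
    "reaches (Dispatch, [(f, int (length w) - 1), ?b, ?b]) (length d * (8 * (L + 1)\<^sup>2))
      (Dispatch, [(f', h'), (table (subset_sums (mset d)) (2 * m), int (2 * m) + 1),
        (table (subset_sums (mset d)) (2 * m), int (2 * m) + 1)])"
    using reaches_all_rounds[OF num, of "{#}" L] len
    unfolding vals by (auto simp: L_def subset_sums_empty sum_mset_sum_list m)
  note r = reaches_trans[OF r f'(2)]
  obtain ts where "reaches (Check_Even, [(f', h'), (table (subset_sums (mset d)) (2 * m), int (m + m)),
      (table (subset_sums (mset d)) (2 * m), int (2 * m))]) (2 * m + 2)
      (if m \<in> subset_sums (mset d) then Accept else Reject, ts)"
    using reaches_Check[OF order_refl] by blast
  \<comment> \<open>On the blank before the input, both heads step back from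
    \<open>2 * m + 1\<close> to the last table cell, the case \<open>n = m\<close> of the
    check.\<close>
  then have "reaches (Dispatch, [(f', h'), (table (subset_sums (mset d)) (2 * m), int (2 * m) + 1),
        (table (subset_sums (mset d)) (2 * m), int (2 * m) + 1)]) (Suc (2 * m + 2))
      (if m \<in> subset_sums (mset d) then Accept else Reject, ts)"
    using f'(1) by - (rule reaches_step, simp add: step_partition_tm delta_def fun_upd_idem)
  note r = reaches_trans[OF r this]
  have "Suc 0 + Suc (length w) + length d * (8 * (L + 1)\<^sup>2) + Suc (2 * m + 2) \<le> 16 * (L + 1) ^ 3"
  proof -
    have "length w \<le> L" "length d \<le> L" "2 * m \<le> L"
      using length_encode_le[of d] m by (auto simp: L_def w_def)
    moreover from this(2) have "length d * (8 * (L + 1)\<^sup>2) \<le> L * (8 * (L + 1)\<^sup>2)" by (rule mult_le_mono1)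
    ultimately have "Suc 0 + Suc (length w) + length d * (8 * (L + 1)\<^sup>2) + Suc (2 * m + 2)
        \<le> 2 * L + 5 + L * (8 * (L + 1)\<^sup>2)"
      by linarith
    also have "\<dots> \<le> 16 * (L + 1) ^ 3"
      by (simp add: power2_eq_square power3_eq_cube algebra_simps)
    finally show ?thesis .
  qed
  from reaches_mono[OF r this] show ?thesis
    unfolding reaches_def answers_within_def L_def w_def
    by (force simp: partition_tm_def m)
qed

theorem theorem21:
  "pseudo_polynomial_time_decidable {d. degree_sequence d} has_bipartite_multigraph_realization"
  unfolding pseudo_polynomial_time_decidable_def
proof (intro exI conjI ballI)
  show "wf_tm partition_tm" by (rule wf_partition_tm)
  fix d assume "d \<in> {d. degree_sequence d}"
  then have d: "degree_sequence d" by simp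
  have "sum_list d div 2 \<in> subset_sums (mset d) \<longleftrightarrow> has_bipartite_multigraph_realization d"
    using half_sum_if_realization realization_if_half_sum[OF d] by blast
  \<comment> \<open>\<open>[:1, 1:]\<close> is the polynomial \<open>1 + X\<close>, so this is the
    cubic bound evaluated at the size measure.\<close>
  then show "answers_within partition_tm (encode d)
      (poly ([:16:] * [:1, 1:] ^ 3) (length d + sum_list d)) (has_bipartite_multigraph_realization d)"
    using partition_tm_answers[of d] d by (simp add: degree_sequence_def)
qed

end
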